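(* Let $X$ be a locally convex space and $\mathcal{S}\subset\mathscr{L}(X)$ an operator semigroup. (i) The Köhler semigroup $\mathcal{K}(\mathcal{S})$ consists of continuous mappings on $X$ if one of the following conditions is fulfilled: (a) for each pointwise bounded subset $M\subset\mathscr{L}(X)$ the pointwise closure $\overline{M}\subset X^X$ is contained in $\mathscr{L}(X)$; (b) the space $X$ is barrelled; (c) $X$ carries the weak topology $\sigma(X,X')$ associated to a barrelled topology on $X$; (d) the semigroup $\mathcal{S}\subset\mathscr{L}(X)$ is equicontinuous. (ii) If $X$ is Montel and $\mathcal{S}$ is bounded, then $\mathcal{K}(\mathcal{S})$ is a compact semitopological subsemigroup of $\mathscr{L}(X)$.
   Context: All vector spaces are complex; topological vector spaces and compact spaces are Hausdorff. $\mathscr{L}(X)$ is the set of continuous linear mappings $X\to X$. An operator semigroup on $X$ is a subsemigroup $\mathcal{S}\subset\mathscr{L}(X)$ (under composition). Its (abstract) Köhler semigroup is the closure $\mathcal{K}(\mathcal{S})=\overline{\mathcal{S}}\subset X^X$, where $X^X$ carries the product topology (topology of pointwise convergence); $\mathcal{K}(\mathcal{S})$ carries the subspace topology and composition as multiplication. A set $M\subset\mathscr{L}(X)$ is pointwise bounded if $\{Tx\mid T\in M\}$ is bounded in $X$ for each $x\in X$; for a semigroup on a Montel space, "bounded" may be read in this sense. In (c), $X'$ is the dual of $X$ with respect to the barrelled (locally convex) topology. A locally convex space is barrelled if every radial (absorbing), convex, circled and closed set is a zero neighborhood; it is Montel if it is barrelled and every bounded subset is relatively compact. A semigroup with a topology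 is semitopological if its multiplication is separately continuous.
   Formalization: In (i)(a)–(c) the semigroup S is additionally assumed pointwise bounded; without this the claim fails, e.g. for S = L(X) on an infinite-dimensional Banach space X, whose pointwise closure contains every discontinuous linear map. *)

theory Defs
  imports "HOL-Analysis.Analysis"
begin

(* A vector space is a type together with a scalar multiplication by complex numbers, and the
   topology is a value of type 'a topology rather than a type class instance, since one space is
   considered under several topologies. *)

definition zero_nhd :: "('a::ab_group_add) topology \<Rightarrow> 'a set \<Rightarrow> bool" where
  "zero_nhd T U \<longleftrightarrow> (\<exists>V. openin T V \<and> 0 \<in> V \<and> V \<subseteq> U)"

definition topological_vector_space ::
    "(complex \<Rightarrow> 'a::ab_group_add \<Rightarrow> 'a) \<Rightarrow> 'a topology \<Rightarrow> bool" where
  "topological_vector_space smul T \<longleftrightarrow>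
     vector_space smul \<and> topspace T = UNIV \<and> Hausdorff_space T \<and>
     continuous_map (prod_topology T T) T (\<lambda>(x, y). x + y) \<and>
     continuous_map (prod_topology euclidean T) T (\<lambda>(c, x). smul c x)"

definition convex_set :: "(complex \<Rightarrow> 'a::ab_group_add \<Rightarrow> 'a) \<Rightarrow> 'a set \<Rightarrow> bool" where
  "convex_set smul C \<longleftrightarrow>
     (\<forall>x\<in>C. \<forall>y\<in>C. \<forall>t::real. 0 \<le> t \<and> t \<le> 1 \<longrightarrow>
        smul (of_real (1 - t)) x + smul (of_real t) y \<in> C)"

definition circled :: "(complex \<Rightarrow> 'a::ab_group_add \<Rightarrow> 'a) \<Rightarrow> 'a set \<Rightarrow> bool" where
  "circled smul C \<longleftrightarrow> (\<forall>c. cmod c \<le> 1 \<longrightarrow> smul c ` C \<subseteq> C)"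

definition absorbs :: "(complex \<Rightarrow> 'a::ab_group_add \<Rightarrow> 'a) \<Rightarrow> 'a set \<Rightarrow> 'a set \<Rightarrow> bool" where
  "absorbs smul A B \<longleftrightarrow> (\<exists>r>0. \<forall>c. r \<le> cmod c \<longrightarrow> B \<subseteq> smul c ` A)"

definition radial :: "(complex \<Rightarrow> 'a::ab_group_add \<Rightarrow> 'a) \<Rightarrow> 'a set \<Rightarrow> bool" where
  "radial smul A \<longleftrightarrow> (\<forall>x. absorbs smul A {x})"

definition bounded_set ::
    "(complex \<Rightarrow> 'a::ab_group_add \<Rightarrow> 'a) \<Rightarrow> 'a topology \<Rightarrow> 'a set \<Rightarrow> bool" where
  "bounded_set smul T B \<longleftrightarrow> (\<forall>U. zero_nhd T U \<longrightarrow> absorbs smul U B)"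

definition locally_convex_space ::
    "(complex \<Rightarrow> 'a::ab_group_add \<Rightarrow> 'a) \<Rightarrow> 'a topology \<Rightarrow> bool" where
  "locally_convex_space smul T \<longleftrightarrow>
     topological_vector_space smul T \<and>
     (\<forall>U. zero_nhd T U \<longrightarrow> (\<exists>C. zero_nhd T C \<and> convex_set smul C \<and> C \<subseteq> U))"

definition barrelled_space ::
    "(complex \<Rightarrow> 'a::ab_group_add \<Rightarrow> 'a) \<Rightarrow> 'a topology \<Rightarrow> bool" where
  "barrelled_space smul T \<longleftrightarrow>
     locally_convex_space smul T \<and>
     (\<forall>B. radial smul B \<and> convex_set smul B \<and> circled smul B \<and> closedin T B \<longrightarrow>
        zero_nhd T B)"

definition montel_space ::
    "(complex \<Rightarrow> 'a::ab_group_add \<Rightarrow> 'a) \<Rightarrow> 'a topology \<Rightarrow> bool" where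
  "montel_space smul T \<longleftrightarrow>
     barrelled_space smul T \<and>
     (\<forall>B. bounded_set smul T B \<longrightarrow> compactin T (T closure_of B))"

definition dual_space ::
    "(complex \<Rightarrow> 'a::ab_group_add \<Rightarrow> 'a) \<Rightarrow> 'a topology \<Rightarrow> ('a \<Rightarrow> complex) set" where
  "dual_space smul T =
     {\<phi>. Vector_Spaces.linear smul (*) \<phi> \<and> continuous_map T euclidean \<phi>}"

definition weak_topology ::
    "(complex \<Rightarrow> 'a::ab_group_add \<Rightarrow> 'a) \<Rightarrow> 'a topology \<Rightarrow> 'a topology" where
  "weak_topology smul T =
     topology_generated_by {\<phi> -` W | \<phi> W. \<phi> \<in> dual_space smul T \<and> open W}"

definition cont_linear_maps ::
    "(complex \<Rightarrow> 'a::ab_group_add \<Rightarrow> 'a) \<Rightarrow> 'a topology \<Rightarrow> ('a \<Rightarrow> 'a) set" where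
  "cont_linear_maps smul T =
     {f. Vector_Spaces.linear smul smul f \<and> continuous_map T T f}"

definition operator_semigroup ::
    "(complex \<Rightarrow> 'a::ab_group_add \<Rightarrow> 'a) \<Rightarrow> 'a topology \<Rightarrow> ('a \<Rightarrow> 'a) set \<Rightarrow> bool" where
  "operator_semigroup smul T S \<longleftrightarrow>
     S \<subseteq> cont_linear_maps smul T \<and> (\<forall>f\<in>S. \<forall>g\<in>S. f \<circ> g \<in> S)"

definition pointwise_topology :: "'a topology \<Rightarrow> ('a \<Rightarrow> 'a) topology" where
  "pointwise_topology T = product_topology (\<lambda>_. T) UNIV"

definition koehler_semigroup :: "'a topology \<Rightarrow> ('a \<Rightarrow> 'a) set \<Rightarrow> ('a \<Rightarrow> 'a) set" where
  "koehler_semigroup T S = pointwise_topology T closure_of S"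

(* Barrelledness controls only pointwise bounded families.  The semigroup of all continuous linear
   operators on an infinite-dimensional Banach space has all linear maps, including the
   discontinuous ones, in its pointwise closure, so the continuity of the Koehler semigroup on a
   barrelled space needs this condition on the semigroup. *)
definition pointwise_bounded ::
    "(complex \<Rightarrow> 'a::ab_group_add \<Rightarrow> 'a) \<Rightarrow> 'a topology \<Rightarrow> ('a \<Rightarrow> 'a) set \<Rightarrow> bool" where
  "pointwise_bounded smul T M \<longleftrightarrow> (\<forall>x. bounded_set smul T {f x | f. f \<in> M})"

definition equicontinuous :: "('a::ab_group_add) topology \<Rightarrow> ('a \<Rightarrow> 'a) set \<Rightarrow> bool" where
  "equicontinuous T M \<longleftrightarrow>
     (\<forall>x V. zero_nhd T V \<longrightarrow>
        (\<exists>U. zero_nhd T U \<and> (\<forall>f\<in>M. \<forall>u\<in>U. f (x + u) - f x \<in> V)))"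

definition semitopological_semigroup :: "'b topology \<Rightarrow> ('b \<Rightarrow> 'b \<Rightarrow> 'b) \<Rightarrow> bool" where
  "semitopological_semigroup T m \<longleftrightarrow>
     (\<forall>a\<in>topspace T. \<forall>b\<in>topspace T. m a b \<in> topspace T) \<and>
     (\<forall>a\<in>topspace T. \<forall>b\<in>topspace T. \<forall>c\<in>topspace T. m (m a b) c = m a (m b c)) \<and>
     (\<forall>a\<in>topspace T. continuous_map T T (\<lambda>x. m a x) \<and> continuous_map T T (\<lambda>x. m x a))"

end

theory Submission
  imports Defs
begin

text \<open>
Linearity passes to pointwise limits, so everything rests on continuity, and for linear maps
continuity at \<open>0\<close> suffices. The pointwise limit of a family of linear maps is continuous as soon
as the family is equicontinuous at \<open>0\<close>: if all members map a zero neighborhood \<open>N\<close> into \<open>V\<close>,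
then the limit maps \<open>N\<close> into the closure of \<open>V\<close>, and closures of zero neighborhoods form a base
(\<open>pointwise_closure_equicontinuous\<close>). Condition (d) is this equicontinuity, and (a) is immediate.

For (b) and (c), equicontinuity comes from the Banach--Steinhaus theorem, which is proved here for
maps from a barrelled topology \<open>T'\<close> to a locally convex topology \<open>T\<close> on the same space
(\<open>banach_steinhaus\<close>). Condition (b) is the case \<open>T' = T\<close>. The use of two topologies is what makes
(c) accessible: members of the semigroup are continuous from the weak topology \<open>T\<close> to itself, hence
also from the finer topology \<open>T'\<close> to \<open>T\<close>. Banach--Steinhaus then makes each limit \<open>f\<close> continuous
from \<open>T'\<close> to \<open>T\<close>, so that \<open>\<phi> \<circ> f\<close> belongs to the dual of \<open>T'\<close> for every \<open>\<phi>\<close> in that dual. This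
says exactly that \<open>f\<close> is weakly continuous (\<open>linear_continuous_into_weak\<close>).

In a Montel space the orbits \<open>{f x | f. f \<in> S}\<close> are relatively compact, so the Koehler semigroup is a
closed subset of a product of compact sets and Tychonoff's theorem applies. Composition is separately
continuous for pointwise convergence because right translations always are, and left translation by
a continuous map is; this first gives closure under composition and then the semitopological property.
\<close>

section \<open>Topological vector spaces given by a topology value\<close>

lemma tvs_basics:
  assumes "topological_vector_space smul T"
  shows tvs_vector_space: "vector_space smul"
    and tvs_topspace: "topspace T = UNIV"
    and tvs_Hausdorff: "Hausdorff_space T"
  using assms by (auto simp: topological_vector_space_def)

lemma tvs_continuous_add:
  assumes "topological_vector_space smul T"
    and "continuous_map Z T f" and "continuous_map Z T g"
  shows "continuous_map Z T (\<lambda>z. f z + g z)"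
proof -
  have "continuous_map Z (prod_topology T T) (\<lambda>z. (f z, g z))"
    using assms by (intro continuous_map_pairedI)
  moreover have "continuous_map (prod_topology T T) T (\<lambda>(x, y). x + y)"
    using assms by (simp add: topological_vector_space_def)
  ultimately have "continuous_map Z T ((\<lambda>(x, y). x + y) \<circ> (\<lambda>z. (f z, g z)))"
    by (rule continuous_map_compose)
  then show ?thesis by (simp add: comp_def)
qed

lemma tvs_continuous_scale:
  assumes "topological_vector_space smul T" and "continuous_map Z T f"
  shows "continuous_map Z T (\<lambda>z. smul c (f z))"
proof -
  have "continuous_map Z (prod_topology euclidean T) (\<lambda>z. (c, f z))"
    using assms by (intro continuous_map_pairedI) auto
  moreover have "continuous_map (prod_topology euclidean T) T (\<lambda>(c, x). smul c x)"
    using assms by (simp add: topological_vector_space_def)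
  ultimately have "continuous_map Z T ((\<lambda>(c, x). smul c x) \<circ> (\<lambda>z. (c, f z)))"
    by (rule continuous_map_compose)
  then show ?thesis by (simp add: comp_def)
qed

lemma tvs_continuous_diff:
  assumes "topological_vector_space smul T"
    and "continuous_map Z T f" and "continuous_map Z T g"
  shows "continuous_map Z T (\<lambda>z. f z - g z)"
proof -
  interpret vector_space smul using assms(1) by (rule tvs_vector_space)
  have "continuous_map Z T (\<lambda>z. f z + smul (-1) (g z))"
    by (intro tvs_continuous_add[OF assms(1)] tvs_continuous_scale[OF assms(1)] assms)
  then show ?thesis by simp
qed

lemma tvs_open_preimage:
  assumes "topological_vector_space smul T" and "continuous_map T T' h" and "openin T' U"
  shows "openin T {x. h x \<in> U}"
  using openin_continuous_map_preimage[OF assms(2,3)] tvs_topspace[OF assms(1)] by simp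

lemma zero_nhd_mono: "zero_nhd T U \<Longrightarrow> U \<subseteq> V \<Longrightarrow> zero_nhd T V"
  unfolding zero_nhd_def by blast

text \<open>
Additivity turns a neighborhood of \<open>f x\<close> into a translate of a zero neighborhood, so continuity at
\<open>x\<close> is continuity at \<open>0\<close> moved by translation.
\<close>

lemma linear_continuous_if_continuous_at_zero:
  assumes T': "topological_vector_space smul T'" and T: "topological_vector_space smul T"
    and lin: "Vector_Spaces.linear smul smul f"
    and zero: "\<And>V. zero_nhd T V \<Longrightarrow> zero_nhd T' (f -` V)"
  shows "continuous_map T' T f"
  unfolding continuous_map
proof (intro conjI allI impI)
  show "f ` topspace T' \<subseteq> topspace T" using tvs_topspace[OF T] by simp
  fix U assume U: "openin T U"
  interpret f: Vector_Spaces.linear smul smul f by fact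
  show "openin T' {x \<in> topspace T'. f x \<in> U}"
  proof (subst openin_subopen, intro ballI)
    fix x assume "x \<in> {x \<in> topspace T'. f x \<in> U}"
    then have x: "f x \<in> U" by simp
    have "openin T {v. f x + v \<in> U}"
      by (rule tvs_open_preimage[OF T _ U])
        (intro tvs_continuous_add[OF T] continuous_map_id[unfolded id_def],
          simp_all add: tvs_topspace[OF T])
    then have "zero_nhd T {v. f x + v \<in> U}"
      unfolding zero_nhd_def using x by (intro exI[of _ "{v. f x + v \<in> U}"]) auto
    from zero[OF this] obtain W where
      W: "openin T' W" "0 \<in> W" "W \<subseteq> f -` {v. f x + v \<in> U}"
      unfolding zero_nhd_def by blast
    have "openin T' {z. z - x \<in> W}"
      by (rule tvs_open_preimage[OF T' _ W(1)])
        (intro tvs_continuous_diff[OF T'] continuous_map_id[unfolded id_def],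
          simp_all add: tvs_topspace[OF T'])
    moreover have "x \<in> {z. z - x \<in> W}" using W by simp
    moreover have "{z. z - x \<in> W} \<subseteq> {x \<in> topspace T'. f x \<in> U}"
      using W(3) by (auto simp: tvs_topspace[OF T'] f.diff)
    ultimately show "\<exists>Ta. openin T' Ta \<and> x \<in> Ta \<and> Ta \<subseteq> {x \<in> topspace T'. f x \<in> U}"
      by blast
  qed
qed

section \<open>Closed, convex, circled zero neighborhoods\<close>

text \<open>
Subtraction is continuous at \<open>(0, 0)\<close>, so there are zero neighborhoods \<open>A\<close>, \<open>B\<close> with \<open>A - B \<subseteq> U\<close>.
A point \<open>z\<close> in the closure of \<open>A\<close> has a point of \<open>A\<close> in its neighborhood \<open>z + B\<close>, hence lies
in \<open>A - B\<close>.
\<close>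

lemma zero_nhd_closure_subset:
  assumes T: "topological_vector_space smul T" and "zero_nhd T U"
  obtains V where "zero_nhd T V" and "T closure_of V \<subseteq> U"
proof -
  obtain U0 where U0: "openin T U0" "0 \<in> U0" "U0 \<subseteq> U"
    using assms(2) unfolding zero_nhd_def by blast
  let ?P = "{p \<in> topspace (prod_topology T T). fst p - snd p \<in> U0}"
  have "openin (prod_topology T T) ?P"
    by (rule openin_continuous_map_preimage[OF _ U0(1)])
      (intro tvs_continuous_diff[OF T] continuous_map_fst continuous_map_snd)
  moreover have "(0, 0) \<in> ?P" using U0 by (simp add: tvs_topspace[OF T])
  ultimately have "\<exists>A B. openin T A \<and> openin T B \<and> 0 \<in> A \<and> 0 \<in> B \<and> A \<times> B \<subseteq> ?P"
    by (rule openin_prod_topology_alt[THEN iffD1, rule_format])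
  then obtain A B where AB: "openin T A" "openin T B" "0 \<in> A" "0 \<in> B" "A \<times> B \<subseteq> ?P"
    by (elim exE conjE)
  have "z \<in> U" if z: "z \<in> T closure_of A" for z
  proof -
    have "openin T {w. w - z \<in> B}"
      by (rule tvs_open_preimage[OF T _ AB(2)])
        (intro tvs_continuous_diff[OF T] continuous_map_id[unfolded id_def],
          simp_all add: tvs_topspace[OF T])
    moreover have "z \<in> {w. w - z \<in> B}" using AB by simp
    ultimately have "\<exists>a. a \<in> A \<and> a \<in> {w. w - z \<in> B}"
      using z unfolding in_closure_of by (elim conjE allE[of _ "{w. w - z \<in> B}"]) blast
    then obtain a where a: "a \<in> A" "a - z \<in> B" by blast
    then have "(a, a - z) \<in> ?P" using AB(5) by blast
    then show ?thesis using U0(3) by auto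
  qed
  moreover have "zero_nhd T A" using AB unfolding zero_nhd_def by blast
  ultimately show thesis using that by blast
qed

text \<open>
For fixed \<open>t\<close>, the convex combination is a continuous map on the product mapping \<open>C \<times> C\<close> into \<open>C\<close>,
hence it maps the closure of \<open>C \<times> C\<close>, the product of the closures, into the closure of \<open>C\<close>.
\<close>

lemma convex_set_closure_of:
  assumes T: "topological_vector_space smul T" and C: "convex_set smul C"
  shows "convex_set smul (T closure_of C)"
  unfolding convex_set_def
proof (intro ballI allI impI)
  fix x y and t :: real
  assume xy: "x \<in> T closure_of C" "y \<in> T closure_of C" and t: "0 \<le> t \<and> t \<le> 1"
  let ?h = "\<lambda>p. smul (of_real (1 - t)) (fst p) + smul (of_real t) (snd p)"
  have "continuous_map (prod_topology T T) T ?h"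
    by (intro tvs_continuous_add[OF T] tvs_continuous_scale[OF T]
        continuous_map_fst continuous_map_snd)
  then have "?h ` (prod_topology T T closure_of (C \<times> C)) \<subseteq> T closure_of (?h ` (C \<times> C))"
    by (rule continuous_map_image_closure_subset)
  moreover have "(x, y) \<in> prod_topology T T closure_of (C \<times> C)"
    using xy by (simp add: closure_of_Times)
  ultimately have "?h (x, y) \<in> T closure_of (?h ` (C \<times> C))" by blast
  moreover have "?h ` (C \<times> C) \<subseteq> C" using C t unfolding convex_set_def by auto
  ultimately show "smul (of_real (1 - t)) x + smul (of_real t) y \<in> T closure_of C"
    using closure_of_mono[of "?h ` (C \<times> C)" C T] by auto
qed

text \<open>
The set in question is the largest circled subset of \<open>U\<close>. It contains a multiple of some zero
neighborhood, since by continuity of scalar multiplication at \<open>(0, 0)\<close> all sufficiently small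
multiples of that neighborhood lie in \<open>U\<close>.
\<close>

lemma zero_nhd_circled_core:
  assumes T: "topological_vector_space smul T" and "zero_nhd T U"
  shows "zero_nhd T {x. \<forall>c. cmod c \<le> 1 \<longrightarrow> smul c x \<in> U}"
proof -
  interpret vector_space smul using T by (rule tvs_vector_space)
  obtain U0 where U0: "openin T U0" "0 \<in> U0" "U0 \<subseteq> U"
    using assms(2) unfolding zero_nhd_def by blast
  let ?P = "{p \<in> topspace (prod_topology euclidean T). (\<lambda>(c, x). smul c x) p \<in> U0}"
  have "openin (prod_topology euclidean T) ?P"
    by (rule openin_continuous_map_preimage[OF _ U0(1)])
      (use T in \<open>simp add: topological_vector_space_def\<close>)
  moreover have "(0, 0) \<in> ?P" using U0 by (simp add: tvs_topspace[OF T])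
  ultimately have
    "\<exists>A B. openin euclidean A \<and> openin T B \<and> 0 \<in> A \<and> 0 \<in> B \<and> A \<times> B \<subseteq> ?P"
    by (rule openin_prod_topology_alt[THEN iffD1, rule_format])
  then obtain A B where
    AB: "openin euclidean A" "openin T B" "0 \<in> A" "0 \<in> B" "A \<times> B \<subseteq> ?P"
    by (elim exE conjE)
  have "open A" using AB(1) by simp
  then obtain d where "d > 0" "ball 0 d \<subseteq> A"
    using AB(3) open_contains_ball by blast
  then have d: "d > 0" "\<And>c. cmod c < d \<Longrightarrow> c \<in> A" by auto
  define k :: complex where "k = of_real (2 / d)"
  \<comment> \<open>The set \<open>(d / 2) B\<close>, written as a preimage.\<close>
  let ?D = "{x. smul k x \<in> B}"
  have "openin T ?D"
    by (rule tvs_open_preimage[OF T _ AB(2)])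
      (intro tvs_continuous_scale[OF T] continuous_map_id[unfolded id_def])
  moreover have "0 \<in> ?D" using AB by simp
  moreover have "?D \<subseteq> {x. \<forall>c. cmod c \<le> 1 \<longrightarrow> smul c x \<in> U}"
  proof (intro subsetI CollectI allI impI)
    fix x c assume x: "x \<in> ?D" and c: "cmod c \<le> 1"
    have "cmod (c / k) = cmod c * d / 2"
      using d by (simp add: k_def norm_divide norm_mult)
    also have "\<dots> < d" using c d mult_right_mono[OF c, of d] by simp
    finally have "(c / k, smul k x) \<in> ?P" using d(2) x AB(5) by blast
    then have "smul (c / k) (smul k x) \<in> U0" by simp
    moreover have "k \<noteq> 0" using d by (simp add: k_def)
    ultimately show "smul c x \<in> U" using U0 by auto
  qed
  ultimately show ?thesis unfolding zero_nhd_def by blast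
qed

text \<open>
The closure \<open>E\<close> of a small convex zero neighborhood is convex and closed. Its circled core is an
intersection of preimages of \<open>E\<close> under the linear homotheties, which keeps both properties.
\<close>

lemma closed_convex_circled_zero_nhd:
  assumes lc: "locally_convex_space smul T" and U: "zero_nhd T U"
  obtains W where "zero_nhd T W" and "closedin T W" and "convex_set smul W"
    and "circled smul W" and "W \<subseteq> U"
proof -
  have T: "topological_vector_space smul T"
    using lc by (simp add: locally_convex_space_def)
  interpret vector_space smul using T by (rule tvs_vector_space)
  obtain V where V: "zero_nhd T V" "T closure_of V \<subseteq> U"
    using zero_nhd_closure_subset[OF T U] .
  obtain C where C: "zero_nhd T C" "convex_set smul C" "C \<subseteq> V"
    using lc V(1) unfolding locally_convex_space_def by blast
  define E where "E = T closure_of C"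
  have E: "convex_set smul E" "closedin T E" "E \<subseteq> U" "zero_nhd T E"
    using convex_set_closure_of[OF T C(2)] closure_of_mono[OF C(3)] V(2)
      zero_nhd_mono[OF C(1)] closure_of_subset[of C T] tvs_topspace[OF T]
    unfolding E_def by auto
  define W where "W = {x. \<forall>c. cmod c \<le> 1 \<longrightarrow> smul c x \<in> E}"
  show thesis
  proof (rule that[of W])
    show "zero_nhd T W" unfolding W_def by (rule zero_nhd_circled_core[OF T E(4)])
    have W: "W = (\<Inter>c\<in>{c. cmod c \<le> 1}. {x \<in> topspace T. smul c x \<in> E})"
      by (auto simp: W_def tvs_topspace[OF T])
    have "closedin T {x \<in> topspace T. smul c x \<in> E}" for c
      by (rule closedin_continuous_map_preimage[OF _ E(2)])
        (intro tvs_continuous_scale[OF T] continuous_map_id[unfolded id_def])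
    moreover have "0 \<in> {c. cmod c \<le> 1}" by simp
    ultimately show "closedin T W" unfolding W by (intro closedin_INT) blast+
    show "convex_set smul W"
      unfolding convex_set_def
    proof (intro ballI allI impI)
      fix x y and t :: real
      assume xy: "x \<in> W" "y \<in> W" and t: "0 \<le> t \<and> t \<le> 1"
      have "smul c (smul (of_real (1 - t)) x + smul (of_real t) y) \<in> E"
        if "cmod c \<le> 1" for c
      proof -
        have "smul (of_real (1 - t)) (smul c x) + smul (of_real t) (smul c y) \<in> E"
          using E(1) xy t that unfolding W_def convex_set_def by blast
        then show ?thesis by (simp add: scale_right_distrib mult.commute)
      qed
      then show "smul (of_real (1 - t)) x + smul (of_real t) y \<in> W"
        unfolding W_def by blast
    qed
    show "circled smul W"
      unfolding W_def circled_def by (auto simp: norm_mult mult_le_one)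
    show "W \<subseteq> U"
    proof
      fix x assume "x \<in> W"
      then have "cmod 1 \<le> 1 \<longrightarrow> smul 1 x \<in> E" unfolding W_def by blast
      then show "x \<in> U" using E(3) by auto
    qed
  qed
qed

section \<open>Banach--Steinhaus\<close>

text \<open>
For \<open>W \<subseteq> V\<close> closed, convex and circled, the intersection of the sets \<open>g -` W\<close> over \<open>g \<in> S\<close> is a
barrel in \<open>T'\<close>: it is radial because \<open>W\<close> absorbs every orbit.
The conclusion is equicontinuity at \<open>0\<close>, from \<open>T'\<close> to \<open>T\<close>.
\<close>

lemma banach_steinhaus:
  assumes barrelled: "barrelled_space smul T'" and lc: "locally_convex_space smul T"
    and lin: "\<And>g. g \<in> S \<Longrightarrow> Vector_Spaces.linear smul smul g"
    and cont: "\<And>g. g \<in> S \<Longrightarrow> continuous_map T' T g"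
    and bdd: "pointwise_bounded smul T S"
    and V: "zero_nhd T V"
  shows "zero_nhd T' {x. \<forall>g\<in>S. g x \<in> V}"
proof -
  have T': "topological_vector_space smul T'"
    using barrelled by (simp add: barrelled_space_def locally_convex_space_def)
  interpret vector_space smul using T' by (rule tvs_vector_space)
  obtain W where W: "zero_nhd T W" "closedin T W" "convex_set smul W" "circled smul W" "W \<subseteq> V"
    using closed_convex_circled_zero_nhd[OF lc V] .
  define B where "B = {x. \<forall>g\<in>S. g x \<in> W}"
  have add: "g (x + y) = g x + g y" and scale: "g (smul c x) = smul c (g x)"
    if "g \<in> S" for g x y c
    using lin[OF that] by (simp_all add: Vector_Spaces.linear_iff)
  have "closedin T' B"
  proof -
    \<comment> \<open>The factor \<open>topspace T'\<close> takes care of an empty \<open>S\<close>.\<close>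
    have "B = topspace T' \<inter> (\<Inter>g\<in>S. {x \<in> topspace T'. g x \<in> W})"
      by (auto simp: B_def tvs_topspace[OF T'])
    also have "closedin T' \<dots>"
      using closedin_continuous_map_preimage[OF cont W(2)]
      by (cases "S = {}") (auto intro!: closedin_Int closedin_INT)
    finally show ?thesis .
  qed
  moreover have "convex_set smul B"
    using W(3) unfolding B_def convex_set_def by (auto simp: add scale)
  moreover have "circled smul B"
    using W(4) unfolding B_def circled_def by (auto simp: scale image_subset_iff)
  moreover have "radial smul B"
    unfolding radial_def
  proof
    fix x
    have "absorbs smul W {g x | g. g \<in> S}"
      using bdd W(1) unfolding pointwise_bounded_def bounded_set_def by blast
    then obtain r where r: "r > 0" "\<And>c. r \<le> cmod c \<Longrightarrow> {g x | g. g \<in> S} \<subseteq> smul c ` W"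
      unfolding absorbs_def by blast
    have "x \<in> smul c ` B" if c: "r \<le> cmod c" for c
    proof
      have c0: "c \<noteq> 0" using c r(1) by auto
      then show "x = smul c (smul (inverse c) x)" by simp
      show "smul (inverse c) x \<in> B"
        unfolding B_def
      proof (intro CollectI ballI)
        fix g assume g: "g \<in> S"
        then obtain w where "w \<in> W" "g x = smul c w" using r(2)[OF c] by blast
        then show "g (smul (inverse c) x) \<in> W" using scale[OF g] c0 by simp
      qed
    qed
    then show "absorbs smul B {x}" unfolding absorbs_def using r(1) by blast
  qed
  ultimately have "zero_nhd T' B" using barrelled unfolding barrelled_space_def by blast
  then show ?thesis by (rule zero_nhd_mono) (use W(5) in \<open>auto simp: B_def\<close>)
qed

section \<open>Pointwise closures\<close>

lemma continuous_map_evaluation: "continuous_map (pointwise_topology T) T (\<lambda>f. f x)"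
  unfolding pointwise_topology_def by (rule continuous_map_product_projection) simp

lemma continuous_map_into_pointwise:
  "continuous_map Z (pointwise_topology T) h \<longleftrightarrow> (\<forall>x. continuous_map Z T (\<lambda>z. h z x))"
  unfolding pointwise_topology_def by (rule continuous_map_componentwise_UNIV)

lemma pointwise_closure_value:
  assumes "f \<in> pointwise_topology T closure_of S" and "\<And>g. g \<in> S \<Longrightarrow> g x \<in> C"
    and "closedin T C"
  shows "f x \<in> C"
proof -
  have "closedin (pointwise_topology T) {g \<in> topspace (pointwise_topology T). g x \<in> C}"
    by (rule closedin_continuous_map_preimage[OF continuous_map_evaluation assms(3)])
  moreover have "topspace (pointwise_topology T) \<inter> S
      \<subseteq> {g \<in> topspace (pointwise_topology T). g x \<in> C}"
    using assms(2) by blast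
  ultimately have "pointwise_topology T closure_of (topspace (pointwise_topology T) \<inter> S)
      \<subseteq> {g \<in> topspace (pointwise_topology T). g x \<in> C}"
    by (intro closure_of_minimal)
  then show ?thesis
    using assms(1) by (subst (asm) closure_of_restrict[symmetric]) blast
qed

text \<open>
Each instance of additivity and homogeneity equates two continuous functions of \<open>f\<close> with values in a
Hausdorff space, so it defines a closed set of maps.
\<close>

lemma pointwise_closure_linear:
  assumes T: "topological_vector_space smul T"
    and lin: "\<And>g. g \<in> S \<Longrightarrow> Vector_Spaces.linear smul smul g"
    and f: "f \<in> pointwise_topology T closure_of S"
  shows "Vector_Spaces.linear smul smul f"
proof -
  let ?P = "pointwise_topology T"
  have top: "topspace ?P = UNIV"
    by (simp add: pointwise_topology_def tvs_topspace[OF T])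
  have "closedin ?P {f \<in> topspace ?P. f (x + y) = f x + f y}" for x y
    by (intro closedin_continuous_maps_eq[OF tvs_Hausdorff[OF T]] tvs_continuous_add[OF T]
        continuous_map_evaluation)
  then have "?P closure_of S \<subseteq> {f \<in> topspace ?P. f (x + y) = f x + f y}" for x y
    by (intro closure_of_minimal) (use lin in \<open>auto simp: Vector_Spaces.linear_iff top\<close>)
  moreover have "closedin ?P {f \<in> topspace ?P. f (smul c x) = smul c (f x)}" for c x
    by (intro closedin_continuous_maps_eq[OF tvs_Hausdorff[OF T]] tvs_continuous_scale[OF T]
        continuous_map_evaluation)
  then have "?P closure_of S \<subseteq> {f \<in> topspace ?P. f (smul c x) = smul c (f x)}" for c x
    by (intro closure_of_minimal) (use lin in \<open>auto simp: Vector_Spaces.linear_iff top\<close>)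
  ultimately show ?thesis
    using f tvs_vector_space[OF T] unfolding Vector_Spaces.linear_iff by blast
qed

text \<open>
If every \<open>g \<in> S\<close> sends \<open>x\<close> into \<open>V\<close>, then \<open>f x\<close> lies in the closure of \<open>V\<close>. The zero neighborhood
supplied by equicontinuity for \<open>V\<close> therefore also serves \<open>f\<close>, at the cost of a closure.
\<close>

lemma pointwise_closure_equicontinuous:
  assumes T': "topological_vector_space smul T'" and T: "topological_vector_space smul T"
    and lin: "\<And>g. g \<in> S \<Longrightarrow> Vector_Spaces.linear smul smul g"
    and equi: "\<And>V. zero_nhd T V \<Longrightarrow> zero_nhd T' {x. \<forall>g\<in>S. g x \<in> V}"
    and f: "f \<in> pointwise_topology T closure_of S"
  shows "continuous_map T' T f"
proof (rule linear_continuous_if_continuous_at_zero[OF T' T pointwise_closure_linear[OF T lin f]])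
  fix U assume "zero_nhd T U"
  then obtain V where V: "zero_nhd T V" "T closure_of V \<subseteq> U"
    using zero_nhd_closure_subset[OF T] by blast
  have "f x \<in> T closure_of V" if "\<forall>g\<in>S. g x \<in> V" for x
    by (rule pointwise_closure_value[OF f])
      (use that closure_of_subset[of V T] in \<open>auto simp: tvs_topspace[OF T]\<close>)
  then show "zero_nhd T' (f -` U)" using V by (intro zero_nhd_mono[OF equi[OF V(1)]]) auto
qed

section \<open>Weak topologies\<close>

lemma dual_continuous_weak:
  assumes "\<phi> \<in> dual_space smul T'"
  shows "continuous_map (weak_topology smul T') euclidean \<phi>"
  unfolding continuous_map_def
proof (intro conjI allI impI)
  let ?G = "{\<phi> -` W | \<phi> W. \<phi> \<in> dual_space smul T' \<and> open W}"
  have G: "\<phi> -` W \<in> ?G" if "open W" for W using assms that by blast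
  have top: "topspace (weak_topology smul T') = UNIV"
    using G[of UNIV] unfolding weak_topology_def topology_generated_by_topspace by auto
  show "\<phi> \<in> topspace (weak_topology smul T') \<rightarrow> topspace euclidean" by simp
  fix W :: "complex set" assume "openin euclidean W"
  then have "openin (weak_topology smul T') (\<phi> -` W)"
    unfolding weak_topology_def by (intro topology_generated_by_Basis G) simp
  then show "openin (weak_topology smul T') {x \<in> topspace (weak_topology smul T'). \<phi> x \<in> W}"
    by (simp add: top vimage_def)
qed

text \<open>
The first hypothesis excludes an empty dual, for which the generated topology would have an empty
underlying set.
\<close>

lemma continuous_map_into_weak:
  assumes top: "topspace (weak_topology smul T') = UNIV"
    and "\<And>\<phi>. \<phi> \<in> dual_space smul T' \<Longrightarrow> continuous_map Z euclidean (\<lambda>z. \<phi> (h z))"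
  shows "continuous_map Z (weak_topology smul T') h"
  unfolding weak_topology_def
proof (rule continuous_on_generated_topo)
  fix U assume "U \<in> {\<phi> -` W | \<phi> W. \<phi> \<in> dual_space smul T' \<and> open W}"
  then obtain \<phi> W where "U = \<phi> -` W" "\<phi> \<in> dual_space smul T'" "open W" by blast
  then show "openin Z (h -` U \<inter> topspace Z)"
    using openin_continuous_map_preimage[OF assms(2), of \<phi> W]
    by (simp add: vimage_def Int_def conj_commute)
next
  show "h ` topspace Z \<subseteq> \<Union> {\<phi> -` W | \<phi> W. \<phi> \<in> dual_space smul T' \<and> open W}"
    using top unfolding weak_topology_def topology_generated_by_topspace by auto
qed

text \<open>
A linear map that is continuous from the original to the weak topology pulls functionals in the dual
back to functionals in the dual, and these are weakly continuous.
\<close>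

lemma linear_continuous_into_weak:
  assumes top: "topspace (weak_topology smul T') = UNIV"
    and lin: "Vector_Spaces.linear smul smul f"
    and cont: "continuous_map T' (weak_topology smul T') f"
  shows "continuous_map (weak_topology smul T') (weak_topology smul T') f"
proof (rule continuous_map_into_weak[OF top])
  fix \<phi> assume \<phi>: "\<phi> \<in> dual_space smul T'"
  have "Vector_Spaces.linear smul (*) (\<phi> \<circ> f)"
    using lin \<phi> unfolding dual_space_def
    by (auto intro: Vector_Spaces.linear_compose)
  moreover have "continuous_map T' euclidean (\<phi> \<circ> f)"
    using cont dual_continuous_weak[OF \<phi>] by (rule continuous_map_compose)
  ultimately have "\<phi> \<circ> f \<in> dual_space smul T'" by (simp add: dual_space_def)
  from dual_continuous_weak[OF this]
  show "continuous_map (weak_topology smul T') euclidean (\<lambda>z. \<phi> (f z))" by (simp add: comp_def)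
qed

section \<open>The Koehler semigroup\<close>

text \<open>
For \<open>s \<in> S\<close>, left translation by \<open>s\<close> is continuous
and maps \<open>S\<close> into \<open>S\<close>, so \<open>s \<circ> g\<close> lies in the closure for every limit \<open>g\<close>. Then right
translation by \<open>g\<close>, which is continuous for an arbitrary map \<open>g\<close>, maps \<open>S\<close> into the closure and
hence also the closure into itself.
\<close>

lemma koehler_composition_closed:
  assumes top: "topspace T = UNIV"
    and S: "\<And>f g. f \<in> S \<Longrightarrow> g \<in> S \<Longrightarrow> f \<circ> g \<in> S"
    and cont: "\<And>f. f \<in> S \<Longrightarrow> continuous_map T T f"
    and f: "f \<in> koehler_semigroup T S" and g: "g \<in> koehler_semigroup T S"
  shows "f \<circ> g \<in> koehler_semigroup T S"
proof -
  let ?P = "pointwise_topology T" and ?K = "koehler_semigroup T S"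
  have closed: "closedin ?P ?K" by (simp add: koehler_semigroup_def)
  have SK: "S \<subseteq> ?K"
    unfolding koehler_semigroup_def
    by (rule closure_of_subset) (simp add: pointwise_topology_def top)
  have K: "h ` ?K \<subseteq> ?K" if "continuous_map ?P ?P h" "h ` S \<subseteq> ?K" for h
  proof -
    have "h ` ?K \<subseteq> ?P closure_of (h ` S)"
      unfolding koehler_semigroup_def using that(1) by (rule continuous_map_image_closure_subset)
    also have "\<dots> \<subseteq> ?K" using that(2) closed by (rule closure_of_minimal)
    finally show ?thesis .
  qed
  have "s \<circ> g \<in> ?K" if s: "s \<in> S" for s
  proof -
    have "continuous_map ?P ?P (\<lambda>k. s \<circ> k)"
      unfolding continuous_map_into_pointwise
      using continuous_map_compose[OF continuous_map_evaluation cont[OF s]]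
      by (simp add: comp_def)
    then have "(\<lambda>k. s \<circ> k) ` ?K \<subseteq> ?K" using S[OF s] SK by (intro K) auto
    then show ?thesis using g by blast
  qed
  moreover have "continuous_map ?P ?P (\<lambda>k. k \<circ> g)"
    unfolding continuous_map_into_pointwise by (simp add: continuous_map_evaluation)
  ultimately have "(\<lambda>k. k \<circ> g) ` ?K \<subseteq> ?K" by (intro K) auto
  then show ?thesis using f by blast
qed

text \<open>
A limit \<open>f\<close> takes its value at \<open>x\<close> in the closure of the orbit of \<open>x\<close>, so the semigroup is a closed
subset of the product of the orbit closures, which is compact by Tychonoff's theorem.
\<close>

lemma koehler_compact:
  assumes top: "topspace T = UNIV"
    and "\<And>x. compactin T (T closure_of {f x | f. f \<in> S})"
  shows "compactin (pointwise_topology T) (koehler_semigroup T S)"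
proof (rule closed_compactin)
  let ?Q = "\<Pi>\<^sub>E x\<in>UNIV. T closure_of {f x | f. f \<in> S}"
  show "compactin (pointwise_topology T) ?Q"
    unfolding pointwise_topology_def using assms(2) by (simp add: compactin_PiE)
  show "koehler_semigroup T S \<subseteq> ?Q"
  proof
    fix f assume f: "f \<in> koehler_semigroup T S"
    have "f x \<in> T closure_of {f x | f. f \<in> S}" for x
    proof (rule pointwise_closure_value[OF f[unfolded koehler_semigroup_def]])
      show "g x \<in> T closure_of {f x | f. f \<in> S}" if "g \<in> S" for g
        using that closure_of_subset[of "{f x | f. f \<in> S}" T] top by blast
    qed simp
    then show "f \<in> ?Q" by (simp add: PiE_def)
  qed
qed (simp add: koehler_semigroup_def)

lemma koehler_semitopological:
  assumes top: "topspace T = UNIV"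
    and comp: "\<And>f g. f \<in> koehler_semigroup T S \<Longrightarrow> g \<in> koehler_semigroup T S \<Longrightarrow>
      f \<circ> g \<in> koehler_semigroup T S"
    and cont: "\<And>f. f \<in> koehler_semigroup T S \<Longrightarrow> continuous_map T T f"
  shows "semitopological_semigroup
    (subtopology (pointwise_topology T) (koehler_semigroup T S)) (\<circ>)"
proof -
  let ?P = "pointwise_topology T" and ?K = "koehler_semigroup T S"
  let ?Q = "subtopology ?P ?K"
  have topK: "topspace ?Q = ?K" by (simp add: pointwise_topology_def top)
  have ev: "continuous_map ?Q T (\<lambda>k. k x)" for x
    by (rule continuous_map_from_subtopology[OF continuous_map_evaluation])
  have "continuous_map ?Q ?Q (\<lambda>k. f \<circ> k)" if f: "f \<in> ?K" for f
  proof (rule continuous_map_into_subtopology)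
    show "continuous_map ?Q ?P (\<lambda>k. f \<circ> k)"
      unfolding continuous_map_into_pointwise
      using continuous_map_compose[OF ev cont[OF f]] by (simp add: comp_def)
  qed (use comp[OF f] topK in auto)
  moreover have "continuous_map ?Q ?Q (\<lambda>k. k \<circ> f)" if f: "f \<in> ?K" for f
  proof (rule continuous_map_into_subtopology)
    show "continuous_map ?Q ?P (\<lambda>k. k \<circ> f)"
      unfolding continuous_map_into_pointwise by (simp add: ev)
  qed (use comp[OF _ f] topK in auto)
  ultimately show ?thesis
    unfolding semitopological_semigroup_def topK using comp by (simp add: comp_assoc)
qed

theorem proposition2p4:
  fixes smul :: "complex \<Rightarrow> 'a::ab_group_add \<Rightarrow> 'a"
    and T :: "'a topology"
    and S :: "('a \<Rightarrow> 'a) set"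
  assumes "locally_convex_space smul T"
    and "operator_semigroup smul T S"
  shows
    "(pointwise_bounded smul T S \<and>
        (\<forall>M. M \<subseteq> cont_linear_maps smul T \<and> pointwise_bounded smul T M \<longrightarrow>
           pointwise_topology T closure_of M \<subseteq> cont_linear_maps smul T)
      \<or> pointwise_bounded smul T S \<and> barrelled_space smul T
      \<or> pointwise_bounded smul T S \<and> (\<exists>T'. barrelled_space smul T' \<and> T = weak_topology smul T')
      \<or> equicontinuous T S
      \<longrightarrow> (\<forall>f\<in>koehler_semigroup T S. continuous_map T T f))
   \<and>
    (montel_space smul T \<and> pointwise_bounded smul T S \<longrightarrow>
      operator_semigroup smul T (koehler_semigroup T S) \<and>
      (let K = subtopology (pointwise_topology T) (koehler_semigroup T S) in
         compact_space K \<and> Hausdorff_space K \<and> semitopological_semigroup K (\<circ>)))"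
proof -
  let ?K = "koehler_semigroup T S"
  have T: "topological_vector_space smul T"
    using assms(1) by (simp add: locally_convex_space_def)
  have S: "S \<subseteq> cont_linear_maps smul T"
    using assms(2) by (simp add: operator_semigroup_def)
  have lin: "Vector_Spaces.linear smul smul g" and cont: "continuous_map T T g"
    if "g \<in> S" for g
    using that S by (auto simp: cont_linear_maps_def)
  have a: "continuous_map T T f"
    if "pointwise_bounded smul T S"
      "\<forall>M. M \<subseteq> cont_linear_maps smul T \<and> pointwise_bounded smul T M \<longrightarrow>
         pointwise_topology T closure_of M \<subseteq> cont_linear_maps smul T"
      "f \<in> ?K" for f
    using that S unfolding koehler_semigroup_def cont_linear_maps_def by blast
  \<comment> \<open>With \<open>T' = T\<close> this is (b); for (c) it is applied to the barrelled topology inducing \<open>T\<close>.\<close>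
  have b: "continuous_map T' T f"
    if bdd: "pointwise_bounded smul T S" and barrelled: "barrelled_space smul T'"
      and cont': "\<And>g. g \<in> S \<Longrightarrow> continuous_map T' T g" and f: "f \<in> ?K" for f T'
  proof (rule pointwise_closure_equicontinuous[OF _ T lin])
    show "topological_vector_space smul T'"
      using barrelled by (simp add: barrelled_space_def locally_convex_space_def)
    show "zero_nhd T' {x. \<forall>g\<in>S. g x \<in> V}" if "zero_nhd T V" for V
      by (rule banach_steinhaus[OF barrelled assms(1) lin cont' bdd that])
    show "f \<in> pointwise_topology T closure_of S" using f by (simp add: koehler_semigroup_def)
  qed
  have c: "continuous_map T T f"
    if bdd: "pointwise_bounded smul T S" and barrelled: "barrelled_space smul T'"
      and weak: "T = weak_topology smul T'" and f: "f \<in> ?K" for f T'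
  proof -
    have top: "topspace (weak_topology smul T') = UNIV" using tvs_topspace[OF T] weak by simp
    have "continuous_map T' T id"
      unfolding weak by (rule continuous_map_into_weak[OF top]) (simp add: dual_space_def)
    then have "continuous_map T' T g" if "g \<in> S" for g
      using continuous_map_compose[OF _ cont[OF that], of T' id] by simp
    then have "continuous_map T' T f" by (rule b[OF bdd barrelled _ f])
    moreover have "Vector_Spaces.linear smul smul f"
      by (rule pointwise_closure_linear[OF T lin f[unfolded koehler_semigroup_def]])
    ultimately show ?thesis
      using linear_continuous_into_weak[OF top] weak by blast
  qed
  have d: "continuous_map T T f" if equi: "equicontinuous T S" and f: "f \<in> ?K" for f
  proof (rule pointwise_closure_equicontinuous[OF T T lin _ f[unfolded koehler_semigroup_def]])
    fix V assume "zero_nhd T V"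
    then obtain U where U: "zero_nhd T U" "\<And>g u. g \<in> S \<Longrightarrow> u \<in> U \<Longrightarrow> g (0 + u) - g 0 \<in> V"
      using equi unfolding equicontinuous_def by meson
    have "g 0 = 0" if "g \<in> S" for g
    proof -
      interpret Vector_Spaces.linear smul smul g using lin[OF that] .
      show ?thesis by (rule zero)
    qed
    then show "zero_nhd T {x. \<forall>g\<in>S. g x \<in> V}"
      using U(2) by (intro zero_nhd_mono[OF U(1)]) force
  qed
  have "operator_semigroup smul T ?K \<and>
      (let K = subtopology (pointwise_topology T) ?K in
         compact_space K \<and> Hausdorff_space K \<and> semitopological_semigroup K (\<circ>))"
    if montel: "montel_space smul T" and bdd: "pointwise_bounded smul T S"
  proof -
    have contK: "continuous_map T T f" if "f \<in> ?K" for f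
      using montel by (intro b[OF bdd _ cont that]) (simp add: montel_space_def)
    have comp: "f \<circ> g \<in> ?K" if "f \<in> ?K" "g \<in> ?K" for f g
      using assms(2) unfolding operator_semigroup_def
      by (intro koehler_composition_closed[OF tvs_topspace[OF T] _ cont that]) auto
    have "?K \<subseteq> cont_linear_maps smul T"
      using contK pointwise_closure_linear[OF T lin]
      by (auto simp: cont_linear_maps_def koehler_semigroup_def)
    then have "operator_semigroup smul T ?K"
      using comp by (simp add: operator_semigroup_def)
    moreover have "compactin (pointwise_topology T) ?K"
      using montel bdd unfolding montel_space_def pointwise_bounded_def
      by (intro koehler_compact[OF tvs_topspace[OF T]]) blast
    then have "compact_space (subtopology (pointwise_topology T) ?K)"
      by (rule compact_space_subtopology)
    moreover have "Hausdorff_space (subtopology (pointwise_topology T) ?K)"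
      unfolding pointwise_topology_def using tvs_Hausdorff[OF T]
      by (intro Hausdorff_space_subtopology) (simp add: Hausdorff_space_product_topology)
    moreover have "semitopological_semigroup (subtopology (pointwise_topology T) ?K) (\<circ>)"
      by (rule koehler_semitopological[OF tvs_topspace[OF T] comp contK])
    ultimately show ?thesis by (simp add: Let_def)
  qed
  then show ?thesis using a b[of T] c d cont by blast
qed

end
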